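(* Let $N\geq 5$ and $m=\lfloor N/2\rfloor$. Let $L$ be the Laplacian matrix of $C_N^2$ (rows and columns indexed by $\mathbb{Z}_N=\{0,1,\dots,N-1\}$), and let $L'$ be obtained from $L$ by deleting the row and column of vertex $0$, indexed by $1,\dots,N-1$. Define the $m\times m$ matrix $H_N$ as follows. If $N$ is odd, $H_N(i,j)=L'(i,j)+L'(i,N-j)$ for $1\le i,j\le m$. If $N$ is even, first set $H_N(i,j)=L'(i,j)+L'(i,N-j)$ for $j\neq m$ and $H_N(i,m)=L'(i,m)$, and then multiply the last row (row $m$) by $\tfrac12$. Let $U_N$ be the $m\times m$ upper triangular matrix with $U_N(i,j)=1$ for $j\ge i$ and $0$ otherwise; let $W_N$ be the $m\times m$ lower bidiagonal matrix with $1$ on the diagonal, $W_N(i+1,i)=F_{2i-1}/F_{2i+1}$ for $1\le i\le m-1$, and all other entries $0$; and let $D_N$ be the $m\times m$ diagonal matrix with $D_N(i,i)=F_{2i+1}/F_{2i-1}$ for $1\le i\le m-1$ and $D_N(m,m)=F_N/F_{2m-1}$. Then \[ H_N=U_N^{-1}\,W_N\,D_N\,{}^tW_N\,{}^tU_N^{-1}. \]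
   Context: $C_N^2$ is the graph with vertex set $\mathbb{Z}_N$ where $u,v$ are adjacent iff $u-v\in\{\pm1,\pm2\}$ mod $N$; its Laplacian is $L=4I-A$ with $A$ the adjacency matrix. $F_i$ is the $i$-th Fibonacci number ($F_0=0,F_1=1$). ${}^tM$ denotes the transpose of $M$. *)

theory Defs
  imports "HOL-Number_Theory.Cong" "HOL-Number_Theory.Fib"
    "Jordan_Normal_Form.Gauss_Jordan_Elimination" "Jordan_Normal_Form.Determinant"
begin

text \<open>
  Matrices of Jordan_Normal_Form are indexed from 0. All matrices below except the adjacency
  matrix and the Laplacian of the graph are naturally indexed from 1, so we write them with
  1-based indices: \<open>mat1 n f\<close> is the \<open>n \<times> n\<close> matrix with entries \<open>f i j\<close> for
  \<open>1 \<le> i, j \<le> n\<close>, and \<open>entry1 A i j\<close> is the entry of \<open>A\<close> in row \<open>i\<close> and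
  column \<open>j\<close>, counted from 1.
\<close>

definition mat1 :: "nat \<Rightarrow> (nat \<Rightarrow> nat \<Rightarrow> 'a) \<Rightarrow> 'a mat" where
  "mat1 n f = mat n n (\<lambda>(i, j). f (i + 1) (j + 1))"

definition entry1 :: "'a mat \<Rightarrow> nat \<Rightarrow> nat \<Rightarrow> 'a" where
  "entry1 A i j = A $$ (i - 1, j - 1)"

text \<open>The graph \<open>C_N^2\<close> has vertices \<open>{0..<N}\<close>, standing for the residues modulo \<open>N\<close>.\<close>

definition sqcycle_adj :: "nat \<Rightarrow> nat \<Rightarrow> nat \<Rightarrow> bool" where
  "sqcycle_adj N u v \<longleftrightarrow> (\<exists>d \<in> {1, -1, 2, -2}. [int u - int v = d] (mod int N))"

definition adjacency_mat :: "nat \<Rightarrow> real mat" where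
  "adjacency_mat N = mat N N (\<lambda>(u, v). if sqcycle_adj N u v then 1 else 0)"

definition laplacian_mat :: "nat \<Rightarrow> real mat" where
  "laplacian_mat N = 4 \<cdot>\<^sub>m 1\<^sub>m N - adjacency_mat N"

text \<open>
  The vertices \<open>1, \<dots>, N - 1\<close> index the rows and columns of the reduced Laplacian,
  so its entry at the vertices \<open>i, j\<close> is \<open>entry1 (reduced_laplacian_mat N) i j\<close>.
\<close>

definition reduced_laplacian_mat :: "nat \<Rightarrow> real mat" where
  "reduced_laplacian_mat N = mat_delete (laplacian_mat N) 0 0"

definition H_mat :: "nat \<Rightarrow> real mat" where
  "H_mat N =
    (let m = N div 2; L' = entry1 (reduced_laplacian_mat N) in
     if odd N then mat1 m (\<lambda>i j. L' i j + L' i (N - j))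
     else multrow (m - 1) (1 / 2)
            (mat1 m (\<lambda>i j. if j \<noteq> m then L' i j + L' i (N - j) else L' i m)))"

definition U_mat :: "nat \<Rightarrow> real mat" where
  "U_mat N = mat1 (N div 2) (\<lambda>i j. if i \<le> j then 1 else 0)"

definition W_mat :: "nat \<Rightarrow> real mat" where
  "W_mat N = mat1 (N div 2) (\<lambda>i j.
     if i = j then 1
     else if i = j + 1 then real (fib (2 * j - 1)) / real (fib (2 * j + 1))
     else 0)"

definition D_mat :: "nat \<Rightarrow> real mat" where
  "D_mat N =
    (let m = N div 2 in mat1 m (\<lambda>i j.
       if i \<noteq> j then 0
       else if i < m then real (fib (2 * i + 1)) / real (fib (2 * i - 1))
       else real (fib N) / real (fib (2 * m - 1))))"

text \<open>The inverse of a square matrix; only meaningful if the matrix is invertible.\<close>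

abbreviation mat_inv :: "'a::field mat \<Rightarrow> 'a mat" where
  "mat_inv A \<equiv> the (mat_inverse A)"

text \<open>The matrices whose inverses are used in the factorization are invertible.\<close>

lemma U_mat_carrier: "U_mat N \<in> carrier_mat (N div 2) (N div 2)"
  by (simp add: U_mat_def mat1_def)

lemma det_U_mat: "det (U_mat N) = 1"
proof -
  have ut: "upper_triangular (U_mat N)"
    by (auto simp: upper_triangular_def U_mat_def mat1_def)
  have "diag_mat (U_mat N) = map (\<lambda>i. 1) [0 ..< N div 2]"
    by (auto simp: diag_mat_def U_mat_def mat1_def)
  then show ?thesis
    using det_upper_triangular[OF ut U_mat_carrier] by (simp add: map_replicate_const)
qed

lemma mat_inverse_eq_Some:
  fixes A :: "'a::field mat"
  assumes A: "A \<in> carrier_mat n n" and det: "det A \<noteq> 0"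
  shows "mat_inverse A = Some (mat_inv A)"
  using mat_inverse(1)[OF A, of "()"] det_non_zero_imp_unit[OF A det, of "()"]
  by (cases "mat_inverse A") auto

lemma U_mat_inverse: "mat_inverse (U_mat N) = Some (mat_inv (U_mat N))"
  by (rule mat_inverse_eq_Some[OF U_mat_carrier]) (simp add: det_U_mat)

lemma U_mat_transpose_inverse:
  "mat_inverse (transpose_mat (U_mat N)) = Some (mat_inv (transpose_mat (U_mat N)))"
  using U_mat_carrier[of N] det_transpose[OF U_mat_carrier, of N] det_U_mat[of N]
  by (intro mat_inverse_eq_Some[of _ "N div 2"]) auto

end

theory Submission
  imports Defs
begin

text \<open>
  The inverse of \<open>U_N\<close> is the upper bidiagonal difference matrix, and
  \<open>U_N H_N \<^sup>tU_N\<close> is tridiagonal: it has off-diagonal entries \<open>1\<close> and diagonal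
  \<open>2, 3, \<dots>, 3, c\<close> with \<open>c = 3\<close> for odd \<open>N\<close> and \<open>c = 2\<close> for even \<open>N\<close>. The
  matrices \<open>W_N\<close> and \<open>D_N\<close> are its LDL decomposition, because
  \<open>F_{k+2} + F_{k-2} = 3 F_k\<close>.
\<close>

section \<open>Sums with few terms and inverses of matrices\<close>

text \<open>All factors are bidiagonal or diagonal, so each entry of a product below has at most two
  nonzero terms. The index \<open>b\<close> may lie outside \<open>A\<close>, which covers the
  boundary rows and columns.\<close>

lemma sum_two_support:
  fixes f :: "nat \<Rightarrow> 'a::comm_monoid_add"
  assumes "finite A" "a \<in> A" "a \<noteq> b" "\<And>k. k \<in> A \<Longrightarrow> k \<noteq> a \<Longrightarrow> k \<noteq> b \<Longrightarrow> f k = 0"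
  shows "sum f A = f a + (if b \<in> A then f b else 0)"
proof -
  have "sum f A = f a + sum f (A - {a})"
    using assms by (simp add: sum.remove)
  also have "sum f (A - {a}) = (if b \<in> A then f b else 0)"
  proof (cases "b \<in> A")
    case True
    then have "sum f (A - {a}) = f b + sum f (A - {a} - {b})"
      using assms by (intro sum.remove) auto
    also have "sum f (A - {a} - {b}) = 0"
      using assms by (intro sum.neutral) auto
    finally show ?thesis using True by simp
  next
    case False
    then show ?thesis using assms by (auto intro!: sum.neutral)
  qed
  finally show ?thesis .
qed

text \<open>A right inverse suffices: multiplicativity of \<open>det\<close> makes \<open>A\<close>
  invertible, so \<open>mat_inv A\<close> is a true inverse and associativity identifies it with
  \<open>B\<close>.\<close>

lemma mat_inv_eqI:
  fixes A :: "'a::field mat"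
  assumes A: "A \<in> carrier_mat n n" and B: "B \<in> carrier_mat n n" and AB: "A * B = 1\<^sub>m n"
  shows "mat_inv A = B"
proof -
  have "det A * det B = 1"
    using det_mult[OF A B] AB by simp
  then have "det A \<noteq> 0" by auto
  then have "mat_inverse A = Some (mat_inv A)"
    by (rule mat_inverse_eq_Some[OF A])
  then have C: "mat_inv A \<in> carrier_mat n n" and CA: "mat_inv A * A = 1\<^sub>m n"
    using mat_inverse(2)[OF A] by auto
  have "mat_inv A = mat_inv A * (A * B)"
    using C by (simp add: AB)
  also have "\<dots> = B"
    using assoc_mult_mat[OF C A B] CA B by simp
  finally show ?thesis .
qed

section \<open>Difference matrices and the inverse of \<open>U_mat\<close>\<close>

definition diff_mat :: "nat \<Rightarrow> real mat" where
  "diff_mat m = mat m m (\<lambda>(i, j). if i = j then 1 else if j = Suc i then -1 else 0)"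

lemma diff_mat_carrier [simp]: "diff_mat m \<in> carrier_mat m m"
  by (simp add: diff_mat_def)

lemma diff_mat_dim [simp]: "dim_row (diff_mat m) = m" "dim_col (diff_mat m) = m"
  by (simp_all add: diff_mat_def)

text \<open>Left multiplication subtracts from each row its successor, with a zero row after the
  last one. Its transpose on the right does the same to columns.\<close>

lemma index_diff_mat_mult:
  assumes "i < m" "j < n" "B \<in> carrier_mat m n"
  shows "(diff_mat m * B) $$ (i, j) = B $$ (i, j) - (if Suc i < m then B $$ (Suc i, j) else 0)"
proof -
  have "(diff_mat m * B) $$ (i, j) = (\<Sum>k\<in>{0..<m}. diff_mat m $$ (i, k) * B $$ (k, j))"
    using assms by (simp add: scalar_prod_def)
  also have "\<dots> = B $$ (i, j) - (if Suc i < m then B $$ (Suc i, j) else 0)"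
    by (subst sum_two_support[where a = i and b = "Suc i"]) (use assms in \<open>auto simp: diff_mat_def\<close>)
  finally show ?thesis .
qed

lemma index_mult_diff_mat_transpose:
  assumes "i < n" "j < m" "B \<in> carrier_mat n m"
  shows "(B * transpose_mat (diff_mat m)) $$ (i, j) =
    B $$ (i, j) - (if Suc j < m then B $$ (i, Suc j) else 0)"
proof -
  have "(B * transpose_mat (diff_mat m)) $$ (i, j) =
      (\<Sum>k\<in>{0..<m}. B $$ (i, k) * diff_mat m $$ (j, k))"
    using assms by (simp add: scalar_prod_def)
  also have "\<dots> = B $$ (i, j) - (if Suc j < m then B $$ (i, Suc j) else 0)"
    by (subst sum_two_support[where a = j and b = "Suc j"]) (use assms in \<open>auto simp: diff_mat_def\<close>)
  finally show ?thesis .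
qed

lemma diff_mat_mult_U_mat: "diff_mat (N div 2) * U_mat N = 1\<^sub>m (N div 2)"
proof (rule eq_matI)
  fix i j
  assume "i < dim_row (1\<^sub>m (N div 2))" "j < dim_col (1\<^sub>m (N div 2))"
  then show "(diff_mat (N div 2) * U_mat N) $$ (i, j) = 1\<^sub>m (N div 2) $$ (i, j)"
    by (subst index_diff_mat_mult[OF _ _ U_mat_carrier]) (auto simp: U_mat_def mat1_def)
qed (simp_all add: U_mat_def mat1_def)

lemma mat_inv_U_mat: "mat_inv (U_mat N) = diff_mat (N div 2)"
  by (intro mat_inv_eqI[OF U_mat_carrier] mat_mult_left_right_inverse[OF _ U_mat_carrier]
      diff_mat_mult_U_mat) simp_all

lemma mat_inv_transpose_U_mat:
  "mat_inv (transpose_mat (U_mat N)) = transpose_mat (diff_mat (N div 2))"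
proof (rule mat_inv_eqI)
  show "transpose_mat (U_mat N) * transpose_mat (diff_mat (N div 2)) = 1\<^sub>m (N div 2)"
    using transpose_mult[OF diff_mat_carrier U_mat_carrier, of N] diff_mat_mult_U_mat[of N]
    by simp
qed (use U_mat_carrier in simp_all)

section \<open>The LDL decomposition of the tridiagonal matrix\<close>

definition tridiag_mat :: "nat \<Rightarrow> real \<Rightarrow> real mat" where
  "tridiag_mat m c = mat m m (\<lambda>(i, j).
     if i = j then (if i = 0 then 2 else if Suc i = m then c else 3)
     else if i = Suc j \<or> j = Suc i then 1 else 0)"

text \<open>With indices counted from 0, the Fibonacci indices no longer contain truncated
  subtraction.\<close>

lemma index_W_mat:
  "i < N div 2 \<Longrightarrow> j < N div 2 \<Longrightarrow> W_mat N $$ (i, j) =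
    (if i = j then 1
     else if i = Suc j then real (fib (2 * j + 1)) / real (fib (2 * j + 3)) else 0)"
  by (auto simp: W_mat_def mat1_def eval_nat_numeral)

lemma index_D_mat:
  "i < N div 2 \<Longrightarrow> j < N div 2 \<Longrightarrow> D_mat N $$ (i, j) =
    (if i \<noteq> j then 0
     else if Suc i < N div 2 then real (fib (2 * i + 3)) / real (fib (2 * i + 1))
     else real (fib N) / real (fib (2 * i + 1)))"
proof -
  assume ij: "i < N div 2" "j < N div 2"
  \<comment> \<open>In the last row \<open>i + 1 = N div 2\<close>, so the denominator there follows
    the same pattern as in the other rows.\<close>
  have "2 * (N div 2) - Suc 0 = 2 * i + 1" if "\<not> Suc i < N div 2"
    using that ij by linarith
  with ij show ?thesis
    by (auto simp: D_mat_def mat1_def Let_def numeral_3_eq_3)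
qed

lemma W_mat_carrier [simp]: "W_mat N \<in> carrier_mat (N div 2) (N div 2)"
  by (simp add: W_mat_def mat1_def)

lemma D_mat_carrier [simp]: "D_mat N \<in> carrier_mat (N div 2) (N div 2)"
  by (simp add: D_mat_def mat1_def Let_def)

lemma index_W_mat_mult_D_mat:
  assumes "i < N div 2" "j < N div 2"
  shows "(W_mat N * D_mat N) $$ (i, j) = W_mat N $$ (i, j) * D_mat N $$ (j, j)"
proof -
  have "(W_mat N * D_mat N) $$ (i, j) =
      (\<Sum>k\<in>{0..<N div 2}. W_mat N $$ (i, k) * D_mat N $$ (k, j))"
    using assms carrier_matD[OF W_mat_carrier, of N] carrier_matD[OF D_mat_carrier, of N]
    by (simp add: scalar_prod_def)
  also have "\<dots> = (\<Sum>k\<in>{0..<N div 2}. if k = j then W_mat N $$ (i, j) * D_mat N $$ (j, j) else 0)"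
    using assms by (intro sum.cong) (auto simp: index_D_mat)
  finally show ?thesis using assms by simp
qed

text \<open>Each subdiagonal entry of \<open>W_mat N\<close> is the reciprocal of the pivot in its
  column, so the off-diagonal entries become 1. The diagonal entries are sums of two Fibonacci
  quotients with a common denominator.\<close>

lemma W_D_transpose_W_mat:
  assumes "N \<ge> 4"
  shows "W_mat N * D_mat N * transpose_mat (W_mat N) =
    tridiag_mat (N div 2) (if odd N then 3 else 2)"
proof (rule eq_matI)
  let ?m = "N div 2" and ?T = "tridiag_mat (N div 2) (if odd N then 3 else 2)"
  fix i j
  assume "i < dim_row ?T" "j < dim_col ?T"
  then have i: "i < ?m" and j: "j < ?m" by (simp_all add: tridiag_mat_def)
  \<comment> \<open>With at least two rows, the first pivot is not the exceptional last one and
    equals \<open>F_3 / F_1 = 2\<close>.\<close>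
  have m: "Suc 0 < ?m" using assms by linarith
  have "(W_mat N * D_mat N * transpose_mat (W_mat N)) $$ (i, j) =
      (\<Sum>k\<in>{0..<?m}. (W_mat N * D_mat N) $$ (i, k) * W_mat N $$ (j, k))"
    using i j carrier_matD[OF W_mat_carrier, of N] carrier_matD[OF D_mat_carrier, of N]
    by (simp add: scalar_prod_def)
  also have "\<dots> = (\<Sum>k\<in>{0..<?m}. W_mat N $$ (i, k) * D_mat N $$ (k, k) * W_mat N $$ (j, k))"
    using i by (intro sum.cong) (simp_all add: index_W_mat_mult_D_mat)
  also have "\<dots> = ?T $$ (i, j)"
  proof (cases i)
    case 0
    \<comment> \<open>Only the term \<open>k = 0\<close> survives; \<open>b = ?m\<close> is chosen
      outside the range to make the second term vanish.\<close>
    have "(\<Sum>k\<in>{0..<?m}. W_mat N $$ (i, k) * D_mat N $$ (k, k) * W_mat N $$ (j, k)) =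
        D_mat N $$ (0, 0) * W_mat N $$ (j, 0)"
      using 0 i j
      by (subst sum_two_support[where a = 0 and b = ?m]) (auto simp: index_W_mat)
    also have "\<dots> = ?T $$ (i, j)"
      using 0 i j m by (auto simp: index_W_mat index_D_mat tridiag_mat_def numeral_3_eq_3)
    finally show ?thesis .
  next
    case (Suc l)
    have pos: "real (fib (2 * l + 1)) > 0" "real (fib (2 * l + 3)) > 0"
      by (simp_all add: fib_neq_0_nat)
    have "(\<Sum>k\<in>{0..<?m}. W_mat N $$ (i, k) * D_mat N $$ (k, k) * W_mat N $$ (j, k)) =
        D_mat N $$ (i, i) * W_mat N $$ (j, i)
        + W_mat N $$ (i, l) * D_mat N $$ (l, l) * W_mat N $$ (j, l)"
      using Suc i j
      by (subst sum_two_support[where a = i and b = l]) (auto simp: index_W_mat)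
    also have "W_mat N $$ (i, l) * D_mat N $$ (l, l) = 1"
      using Suc i pos by (simp add: index_W_mat index_D_mat)
    also have "D_mat N $$ (i, i) * W_mat N $$ (j, i) + 1 * W_mat N $$ (j, l) = ?T $$ (i, j)"
    proof -
      consider "j = i" | "j = Suc i" | "j = l" | "j \<noteq> i" "j \<noteq> Suc i" "j \<noteq> l" by blast
      then show ?thesis
      proof cases
        case 1
        \<comment> \<open>The numerator index \<open>n\<close> is left open: it is
          \<open>2 * l + 5\<close> before the last row and \<open>N\<close> in the last row. There
          \<open>N div 2 = l + 2\<close>, so \<open>N\<close> is \<open>2 * l + 5\<close> or
          \<open>2 * l + 4\<close> according to parity.\<close>
        have *: "real (fib n) / real (fib (2 * l + 3)) + real (fib (2 * l + 1)) / real (fib (2 * l + 3)) = c"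
          if "real (fib n) + real (fib (2 * l + 1)) = c * real (fib (2 * l + 3))" for n c
          using that pos by (simp add: add_divide_distrib[symmetric])
        have 3: "real (fib (2 * l + 5)) + real (fib (2 * l + 1)) = 3 * real (fib (2 * l + 3))"
          by (simp add: eval_nat_numeral)
        have 2: "real (fib (2 * l + 4)) + real (fib (2 * l + 1)) = 2 * real (fib (2 * l + 3))"
          by (simp add: eval_nat_numeral)
        show ?thesis
        proof (cases "Suc i < ?m")
          case True
          with 1 Suc i *[OF 3] show ?thesis
            by (simp add: index_W_mat index_D_mat tridiag_mat_def eval_nat_numeral add.commute
                del: fib.simps)
        next
          case False
          show ?thesis
          proof (cases "odd N")
            case True
            with False i Suc have "N = 2 * l + 5" by presburger
            with 1 Suc i False True *[OF 3] show ?thesis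
              by (simp add: index_W_mat index_D_mat tridiag_mat_def eval_nat_numeral add.commute
                  del: fib.simps)
          next
            case even: False
            with False i Suc have "N = 2 * l + 4" by presburger
            with 1 Suc i False even *[OF 2] show ?thesis
              by (simp add: index_W_mat index_D_mat tridiag_mat_def eval_nat_numeral add.commute
                  del: fib.simps)
          qed
        qed
      next
        case 2
        have "real (fib (2 * i + 1)) > 0" "real (fib (2 * i + 3)) > 0"
          by (simp_all add: fib_neq_0_nat)
        with 2 Suc i j show ?thesis
          by (simp add: index_W_mat index_D_mat tridiag_mat_def)
      next
        case 3
        with Suc i show ?thesis by (simp add: index_W_mat tridiag_mat_def)
      next
        case 4
        with Suc i j show ?thesis by (auto simp: index_W_mat tridiag_mat_def)
      qed
    qed
    finally show ?thesis .
  qed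
  finally show "(W_mat N * D_mat N * transpose_mat (W_mat N)) $$ (i, j) = ?T $$ (i, j)" .
qed (use carrier_matD[OF W_mat_carrier, of N] in \<open>simp_all add: tridiag_mat_def\<close>)

section \<open>Entries of the reduced Laplacian and of \<open>H_mat\<close>\<close>

text \<open>Writing the congruences as equations over the naturals leaves the later case
  distinctions to linear arithmetic.\<close>

lemma sqcycle_adj_iff:
  assumes "u < N" "v < N" "N \<ge> 3"
  shows "sqcycle_adj N u v \<longleftrightarrow>
    u + 1 = v \<or> u + 2 = v \<or> v + 1 = u \<or> v + 2 = u \<or>
    u + 1 = v + N \<or> u + 2 = v + N \<or> v + 1 = u + N \<or> v + 2 = u + N"
proof -
  have *: "[int u - int v = d] (mod int N) \<longleftrightarrow>
      int u - int v = d \<or> int u - int v = d - int N \<or> int u - int v = d + int N"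
    if "\<bar>d\<bar> \<le> 2" for d
  proof
    assume "[int u - int v = d] (mod int N)"
    then obtain k where k: "int u - int v = d + int N * k"
      using cong_iff_lin[of d "int u - int v" "int N"] by (auto dest: cong_sym)
    \<comment> \<open>Vertices differ by at most \<open>N - 1\<close> and \<open>d\<close> is at
      most 2 in absolute value, so the multiple of \<open>N\<close> is at most
      \<open>N + 1 < 2 * N\<close> in absolute value.\<close>
    have "int N * k < int N * 2" "int N * (-2) < int N * k"
      using k assms that by linarith+
    then have "k < 2" "-2 < k"
      by (simp_all only: mult_left_less_imp_less[OF _ of_nat_0_le_iff])
    then have "k = -1 \<or> k = 0 \<or> k = 1" by auto
    with k show "int u - int v = d \<or> int u - int v = d - int N \<or> int u - int v = d + int N"
      by auto
  next
    assume "int u - int v = d \<or> int u - int v = d - int N \<or> int u - int v = d + int N"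
    then show "[int u - int v = d] (mod int N)"
      by (auto simp: cong_def)
  qed
  show ?thesis
    unfolding sqcycle_adj_def using assms by (simp add: *) linarith
qed

lemma entry1_reduced_laplacian_mat:
  assumes "1 \<le> i" "i < N" "1 \<le> j" "j < N"
  shows "entry1 (reduced_laplacian_mat N) i j =
    (if i = j then 4 else 0) - (if sqcycle_adj N i j then 1 else 0)"
  using assms
  by (auto simp: entry1_def reduced_laplacian_mat_def mat_delete_def laplacian_mat_def
      adjacency_mat_def)

text \<open>Two vertices of the lower half cannot be adjacent around the cycle. The mirror image
  \<open>N - Suc j\<close> is reached either across the middle or, for \<open>i + j = 0\<close>,
  past the deleted vertex 0, which joins 1 and \<open>N - 1\<close>.\<close>

lemma sqcycle_adj_lower_half:
  assumes "N \<ge> 5" "i < N div 2" "j < N div 2"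
  shows "sqcycle_adj N (Suc i) (Suc j) \<longleftrightarrow>
      j = i + 1 \<or> j = i + 2 \<or> i = j + 1 \<or> i = j + 2"
    and "sqcycle_adj N (Suc i) (N - Suc j) \<longleftrightarrow> i + j + 3 = N \<or> i + j + 4 = N \<or> i + j = 0"
proof -
  have *: "Suc i < N" "Suc j < N" "N - Suc j < N" "3 \<le> N" "2 * i + 2 \<le> N" "2 * j + 2 \<le> N"
    using assms by linarith+
  show "sqcycle_adj N (Suc i) (Suc j) \<longleftrightarrow>
      j = i + 1 \<or> j = i + 2 \<or> i = j + 1 \<or> i = j + 2"
    unfolding sqcycle_adj_iff[OF *(1,2,4)] using * assms(1) by linarith
  show "sqcycle_adj N (Suc i) (N - Suc j) \<longleftrightarrow> i + j + 3 = N \<or> i + j + 4 = N \<or> i + j = 0"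
    unfolding sqcycle_adj_iff[OF *(1,3,4)] using * assms(1) by linarith
qed

lemma entry1_reduced_laplacian_lower_half:
  assumes "N \<ge> 5" "i < N div 2" "j < N div 2"
  shows "entry1 (reduced_laplacian_mat N) (Suc i) (Suc j) =
      (if i = j then 4
       else if j = i + 1 \<or> j = i + 2 \<or> i = j + 1 \<or> i = j + 2 then -1 else 0)"
    and "entry1 (reduced_laplacian_mat N) (Suc i) (N - Suc j) =
      (if i + j + 2 = N then 4
       else if i + j + 3 = N \<or> i + j + 4 = N \<or> i + j = 0 then -1 else 0)"
proof -
  have *: "Suc i < N" "Suc j < N" "1 \<le> N - Suc j" "N - Suc j < N"
    using assms by linarith+
  show "entry1 (reduced_laplacian_mat N) (Suc i) (Suc j) =
      (if i = j then 4
       else if j = i + 1 \<or> j = i + 2 \<or> i = j + 1 \<or> i = j + 2 then -1 else 0)"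
    using * by (simp add: entry1_reduced_laplacian_mat sqcycle_adj_lower_half[OF assms])
  \<comment> \<open>In this range equality forces \<open>N\<close> even and both vertices to be
    \<open>N div 2\<close>, the vertex fixed by the reflection.\<close>
  have "Suc i = N - Suc j \<longleftrightarrow> i + j + 2 = N"
    using * by linarith
  then show "entry1 (reduced_laplacian_mat N) (Suc i) (N - Suc j) =
      (if i + j + 2 = N then 4
       else if i + j + 3 = N \<or> i + j + 4 = N \<or> i + j = 0 then -1 else 0)"
    using * assms(1)
    by (simp only: entry1_reduced_laplacian_mat sqcycle_adj_lower_half[OF assms]) auto
qed

text \<open>The right-hand side is an entry of
  \<open>diff_mat m * T * transpose_mat (diff_mat m)\<close> written as a double difference. For
  even \<open>N\<close>, the halved last row and the unfolded last column account for the fixed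
  vertex \<open>m\<close>.\<close>

lemma index_H_mat:
  assumes "N \<ge> 5" "i < N div 2" "j < N div 2"
  shows "H_mat N $$ (i, j) =
    (let m = N div 2; T = tridiag_mat m (if odd N then 3 else 2) in
      T $$ (i, j) - (if Suc i < m then T $$ (Suc i, j) else 0)
      - (if Suc j < m then T $$ (i, Suc j) - (if Suc i < m then T $$ (Suc i, Suc j) else 0) else 0))"
proof (cases "odd N")
  case True
  then obtain m where N: "N = 2 * m + 1" by (rule oddE)
  have m: "i < m" "j < m" "m \<ge> 2" "N div 2 = m"
    using assms N by auto
  have "H_mat N $$ (i, j) =
      entry1 (reduced_laplacian_mat N) (Suc i) (Suc j)
      + entry1 (reduced_laplacian_mat N) (Suc i) (N - Suc j)"
    using m True by (simp add: H_mat_def mat1_def Let_def)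
  with m True show ?thesis
    unfolding entry1_reduced_laplacian_lower_half[OF assms] Let_def m(4) tridiag_mat_def
    by (auto simp: N)
next
  case False
  then obtain m where N: "N = 2 * m" by auto
  have m: "i < m" "j < m" "m \<ge> 3" "N div 2 = m"
    using assms N by auto
  have "H_mat N $$ (i, j) = (if Suc i = m then 1 / 2 else 1) *
      (entry1 (reduced_laplacian_mat N) (Suc i) (Suc j)
      + (if Suc j = m then 0 else entry1 (reduced_laplacian_mat N) (Suc i) (N - Suc j)))"
    using m False by (auto simp: H_mat_def mat1_def Let_def)
  with m False show ?thesis
    unfolding entry1_reduced_laplacian_lower_half[OF assms] Let_def m(4) tridiag_mat_def
    by (auto simp: N)
qed

section \<open>Assembly of the factorization\<close>

theorem theorem3p1:
  fixes N :: nat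
  assumes "N \<ge> 5"
  shows "H_mat N =
    mat_inv (U_mat N) * W_mat N * D_mat N * transpose_mat (W_mat N)
      * mat_inv (transpose_mat (U_mat N))"
proof -
  define m where "m = N div 2"
  define T where "T = tridiag_mat m (if odd N then 3 else 2)"
  have T [simp]: "T \<in> carrier_mat m m"
    by (simp add: T_def tridiag_mat_def)
  have carrier [simp]: "W_mat N \<in> carrier_mat m m" "D_mat N \<in> carrier_mat m m"
    by (simp_all add: m_def)
  \<comment> \<open>Reassociation isolates the product of the three middle factors, which is then
    replaced by \<open>T\<close>.\<close>
  have "mat_inv (U_mat N) * W_mat N * D_mat N * transpose_mat (W_mat N) =
      diff_mat m * (W_mat N * D_mat N * transpose_mat (W_mat N))"
    using assoc_mult_mat[of "diff_mat m" m m "W_mat N" m "D_mat N" m]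
      assoc_mult_mat[of "diff_mat m" m m "W_mat N * D_mat N" m "transpose_mat (W_mat N)" m]
    by (simp add: mat_inv_U_mat mult_carrier_mat[of _ m m] flip: m_def)
  also have "W_mat N * D_mat N * transpose_mat (W_mat N) = T"
    using W_D_transpose_W_mat[of N] assms by (simp add: T_def m_def)
  finally have eq: "mat_inv (U_mat N) * W_mat N * D_mat N * transpose_mat (W_mat N)
      * mat_inv (transpose_mat (U_mat N)) = diff_mat m * T * transpose_mat (diff_mat m)"
    by (simp add: mat_inv_transpose_U_mat flip: m_def)
  have "H_mat N = diff_mat m * T * transpose_mat (diff_mat m)"
  proof (rule eq_matI)
    fix i j
    assume "i < dim_row (diff_mat m * T * transpose_mat (diff_mat m))"
      "j < dim_col (diff_mat m * T * transpose_mat (diff_mat m))"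
    then have i: "i < m" and j: "j < m" by simp_all
    have DT: "diff_mat m * T \<in> carrier_mat m m"
      by (rule mult_carrier_mat[OF diff_mat_carrier T])
    show "H_mat N $$ (i, j) = (diff_mat m * T * transpose_mat (diff_mat m)) $$ (i, j)"
      \<comment> \<open>The difference rules turn the triple product into the double difference of
        \<open>index_H_mat\<close>; \<open>index_mult_mat(1)\<close> is removed because it would
        expand the products into scalar products.\<close>
      using i j index_H_mat[OF assms i[unfolded m_def] j[unfolded m_def],
          unfolded Let_def, folded m_def, folded T_def]
      by (simp add: index_mult_diff_mat_transpose[OF _ _ DT] index_diff_mat_mult[OF _ _ T]
          del: index_mult_mat(1))
  qed (simp_all add: H_mat_def mat1_def Let_def m_def)
  with eq show ?thesis by simp
qed

end
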